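(* Let $q$ be a prime power and $m\ge 1$ a natural number. Then there is an isomorphism of monoids $$T_q^m\;\cong\;\prod_{k\mid m}\left(M_{[\pi(k)]}\ltimes_\Gamma C_k^{\pi(k)}\right),$$ where the (direct) product runs over all positive divisors $k$ of $m$.
   Context: A map $f:\mathbb{F}_{q^m}\to\mathbb{F}_{q^m}$ is called subfield preserving if $f(\mathbb{F}_q)\subseteq\mathbb{F}_q$ and, for all positive divisors $d,s$ of $m$, $f(\mathbb{F}_{q^d}\setminus\mathbb{F}_{q^s})\subseteq\mathbb{F}_{q^d}\setminus\mathbb{F}_{q^s}$. $T_q^m$ denotes the set of subfield preserving maps $f:\mathbb{F}_{q^m}\to\mathbb{F}_{q^m}$ whose polynomial representation (the unique polynomial of degree less than $q^m$ inducing $f$) has coefficients in $\mathbb{F}_q$; it is a monoid under composition. $\pi(k)$ is the number of monic irreducible polynomials of degree $k$ over $\mathbb{F}_q$, i.e. $\pi(k)=\frac1k\sum_{j\mid k}\mu(k/j)q^j$ with $\mu$ the Möbius function. For a natural number $n$, $[n]=\{1,\dots,n\}$ and $M_{[n]}$ is the monoid (under composition) of all maps $[n]\to[n]$. $C_k$ is the cyclic group of order $k$. Semidirect product of monoids: given monoids $M,N$ and an antihomomorphism of monoids $\Gamma:M\to\operatorname{End}(N)$, $m\mapsto\Gamma_m$ (so $\Gamma_{m_1m_2}=\Gamma_{m_2}\circ\Gamma_{m_1}$), $M\ltimes_\Gamma N$ is the monoid with underlying set $M\times N$ and operation $(m_1,n_1)*(m_2,n_2)=(m_1m_2,\Gamma_{m_2}(n_1)\,n_2)$.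 Here $\Gamma:M_{[n]}\to\operatorname{End}(C_k^n)$ is given by $\Gamma_\sigma(\gamma_1,\dots,\gamma_n)=(\gamma_{\sigma(1)},\dots,\gamma_{\sigma(n)})$, with $n=\pi(k)$. *)

theory Defs
  imports "HOL-Algebra.Algebra" "HOL-Number_Theory.Prime_Powers"
begin

section \<open>Finite subfields and polynomial representations\<close>

text \<open>
  For a finite field \<open>R\<close> with \<open>q ^ m\<close> elements and a positive divisor \<open>d\<close> of \<open>m\<close>, there is exactly
  one subfield with \<open>q ^ d\<close> elements, so the description is then well defined.
\<close>

definition subfield_of_card :: "('a, 'b) ring_scheme \<Rightarrow> nat \<Rightarrow> 'a set" where
  "subfield_of_card R n = (THE K. subfield K R \<and> card K = n)"

text \<open>
  Polynomials are coefficient lists, and \<open>degree [] = 0\<close>. The bound excludes every nonzero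
  polynomial of degree at least \<open>card (carrier R)\<close>, which makes the representation unique.
\<close>

definition poly_rep :: "('a, 'b) ring_scheme \<Rightarrow> ('a \<Rightarrow> 'a) \<Rightarrow> 'a list" where
  "poly_rep R f = (THE p. p \<in> carrier (poly_ring R) \<and> degree p < card (carrier R) \<and>
                          (\<forall>x\<in>carrier R. ring.eval R p x = f x))"

definition num_monic_irreducible :: "('a, 'b) ring_scheme \<Rightarrow> 'a set \<Rightarrow> nat \<Rightarrow> nat" where
  "num_monic_irreducible R K k =
     card {p \<in> carrier (K[X]\<^bsub>R\<^esub>). pirreducible\<^bsub>R\<^esub> K p \<and> lead_coeff p = \<one>\<^bsub>R\<^esub> \<and> degree p = k}"


section \<open>The monoid of subfield preserving maps\<close>

definition subfield_preserving :: "('a, 'b) ring_scheme \<Rightarrow> nat \<Rightarrow> nat \<Rightarrow> ('a \<Rightarrow> 'a) \<Rightarrow> bool" where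
  "subfield_preserving R q m f \<longleftrightarrow>
     f ` subfield_of_card R q \<subseteq> subfield_of_card R q \<and>
     (\<forall>d s. d dvd m \<longrightarrow> s dvd m \<longrightarrow>
        f ` (subfield_of_card R (q ^ d) - subfield_of_card R (q ^ s))
          \<subseteq> subfield_of_card R (q ^ d) - subfield_of_card R (q ^ s))"

text \<open>
  As in \<^const>\<open>BijGroup\<close>, maps on a carrier set are represented by extensional functions.
\<close>

definition subfield_preserving_monoid ::
  "('a, 'b) ring_scheme \<Rightarrow> nat \<Rightarrow> nat \<Rightarrow> ('a \<Rightarrow> 'a) monoid" where
  "subfield_preserving_monoid R q m =
     \<lparr>carrier = {f \<in> carrier R \<rightarrow>\<^sub>E carrier R.
                  subfield_preserving R q m f \<and> set (poly_rep R f) \<subseteq> subfield_of_card R q},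
      monoid.mult = compose (carrier R),
      one = (\<lambda>x\<in>carrier R. x)\<rparr>"


section \<open>Transformation monoids and semidirect products of monoids\<close>

definition transformation_monoid :: "'a set \<Rightarrow> ('a \<Rightarrow> 'a) monoid" where
  "transformation_monoid S =
     \<lparr>carrier = S \<rightarrow>\<^sub>E S, monoid.mult = compose S, one = (\<lambda>x\<in>S. x)\<rparr>"

locale monoid_antiaction = M: monoid M + N: monoid N
  for M :: "('m, 'c) monoid_scheme" (structure) and N :: "('n, 'd) monoid_scheme" (structure) +
  fixes \<Gamma> :: "'m \<Rightarrow> 'n \<Rightarrow> 'n"
  assumes endo_hom: "a \<in> carrier M \<Longrightarrow> \<Gamma> a \<in> hom N N"
    and endo_one: "a \<in> carrier M \<Longrightarrow> \<Gamma> a \<one>\<^bsub>N\<^esub> = \<one>\<^bsub>N\<^esub>"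
    and anti_mult: "\<lbrakk>a \<in> carrier M; b \<in> carrier M; x \<in> carrier N\<rbrakk>
                      \<Longrightarrow> \<Gamma> (a \<otimes>\<^bsub>M\<^esub> b) x = \<Gamma> b (\<Gamma> a x)"
    and anti_one: "x \<in> carrier N \<Longrightarrow> \<Gamma> \<one>\<^bsub>M\<^esub> x = x"

definition semidirect_product ::
  "('m, 'c) monoid_scheme \<Rightarrow> ('m \<Rightarrow> 'n \<Rightarrow> 'n) \<Rightarrow> ('n, 'd) monoid_scheme \<Rightarrow> ('m \<times> 'n) monoid" where
  "semidirect_product M \<Gamma> N =
     \<lparr>carrier = carrier M \<times> carrier N,
      monoid.mult = (\<lambda>(m1, n1) (m2, n2). (m1 \<otimes>\<^bsub>M\<^esub> m2, \<Gamma> m2 n1 \<otimes>\<^bsub>N\<^esub> n2)),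
      one = (\<one>\<^bsub>M\<^esub>, \<one>\<^bsub>N\<^esub>)\<rparr>"

definition reindex :: "'i set \<Rightarrow> ('i \<Rightarrow> 'i) \<Rightarrow> ('i \<Rightarrow> 'a) \<Rightarrow> ('i \<Rightarrow> 'a)" where
  "reindex I \<sigma> \<gamma> = (\<lambda>i\<in>I. \<gamma> (\<sigma> i))"

text \<open>
  This is \<open>M\<^sub>[\<^sub>n\<^sub>] \<ltimes>\<^sub>\<Gamma> C\<^sub>k\<^sup>n\<close>. The group \<^term>\<open>integer_mod_group k\<close> is cyclic of order \<open>k\<close> for \<open>k > 0\<close>.
\<close>

definition transformation_wreath :: "nat \<Rightarrow> nat \<Rightarrow> ((nat \<Rightarrow> nat) \<times> (nat \<Rightarrow> int)) monoid" where
  "transformation_wreath n k =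
     semidirect_product (transformation_monoid {1..n}) (reindex {1..n})
       (product_group {1..n} (\<lambda>_. integer_mod_group k))"


text \<open>
  \<^const>\<open>iso\<close> only asks for compatibility with multiplication.
\<close>

definition monoid_isomorphic :: "('a, 'c) monoid_scheme \<Rightarrow> ('b, 'd) monoid_scheme \<Rightarrow> bool" where
  "monoid_isomorphic G H \<longleftrightarrow> (\<exists>\<phi>\<in>iso G H. \<phi> \<one>\<^bsub>G\<^esub> = \<one>\<^bsub>H\<^esub>)"


section \<open>The constructions yield monoids\<close>

lemma monoid_transformation_monoid: "monoid (transformation_monoid S)"
proof (rule monoidI, unfold transformation_monoid_def, simp_all only: monoid.simps partial_object.simps)
  fix f g h assume *: "f \<in> S \<rightarrow>\<^sub>E S" "g \<in> S \<rightarrow>\<^sub>E S" "h \<in> S \<rightarrow>\<^sub>E S"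
  then show "compose S f g \<in> S \<rightarrow>\<^sub>E S"
    by (auto simp: compose_def)
  show "compose S (compose S f g) h = compose S f (compose S g h)"
    by (rule ext) (use * in \<open>auto simp: compose_def restrict_def\<close>)
next
  fix f assume *: "f \<in> S \<rightarrow>\<^sub>E S"
  then show "compose S (\<lambda>x\<in>S. x) f = f" and "compose S f (\<lambda>x\<in>S. x) = f"
    by (auto intro!: Id_compose compose_Id simp: PiE_iff)
qed auto

lemma (in monoid_antiaction) monoid_semidirect_product: "monoid (semidirect_product M \<Gamma> N)"
proof -
  have closed: "\<Gamma> a x \<in> carrier N" if "a \<in> carrier M" "x \<in> carrier N" for a x
    using endo_hom[OF that(1)] that(2) by (auto simp: hom_def)
  have mult: "\<Gamma> a (x \<otimes>\<^bsub>N\<^esub> y) = \<Gamma> a x \<otimes>\<^bsub>N\<^esub> \<Gamma> a y"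
    if "a \<in> carrier M" "x \<in> carrier N" "y \<in> carrier N" for a x y
    using endo_hom[OF that(1)] that by (auto simp: hom_def)
  show ?thesis
    by (rule monoidI)
       (auto simp: semidirect_product_def closed mult endo_one anti_mult anti_one
                   M.m_assoc N.m_assoc)
qed

lemma monoid_product_group:
  assumes "\<And>i. i \<in> I \<Longrightarrow> monoid (G i)"
  shows "monoid (product_group I G)"
proof -
  note [simp] = monoid.m_closed[OF assms] monoid.one_closed[OF assms] monoid.m_assoc[OF assms]
    monoid.l_one[OF assms] monoid.r_one[OF assms]
  show ?thesis
  proof (rule monoidI)
    fix x y z
    assume *: "x \<in> carrier (product_group I G)" "y \<in> carrier (product_group I G)"
      "z \<in> carrier (product_group I G)"
    then show "x \<otimes>\<^bsub>product_group I G\<^esub> y \<in> carrier (product_group I G)"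
      by (auto simp: PiE_iff)
    show "x \<otimes>\<^bsub>product_group I G\<^esub> y \<otimes>\<^bsub>product_group I G\<^esub> z =
          x \<otimes>\<^bsub>product_group I G\<^esub> (y \<otimes>\<^bsub>product_group I G\<^esub> z)"
      using * by (auto simp: PiE_iff intro!: restrict_ext)
  next
    fix x assume *: "x \<in> carrier (product_group I G)"
    then show "\<one>\<^bsub>product_group I G\<^esub> \<otimes>\<^bsub>product_group I G\<^esub> x = x"
      and "x \<otimes>\<^bsub>product_group I G\<^esub> \<one>\<^bsub>product_group I G\<^esub> = x"
      by (auto simp: PiE_iff intro!: extensionalityI[of _ I])
  qed auto
qed

lemma monoid_antiaction_reindex:
  assumes "monoid N"
  shows "monoid_antiaction (transformation_monoid I) (product_group I (\<lambda>_. N)) (reindex I)"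
proof -
  interpret N: monoid N by fact
  interpret M: monoid "transformation_monoid I" by (rule monoid_transformation_monoid)
  interpret P: monoid "product_group I (\<lambda>_. N)" by (intro monoid_product_group assms)
  show ?thesis
  proof unfold_locales
    fix \<sigma> assume \<sigma>: "\<sigma> \<in> carrier (transformation_monoid I)"
    then have [simp]: "\<sigma> i \<in> I" if "i \<in> I" for i
      using that by (auto simp: transformation_monoid_def)
    show "reindex I \<sigma> \<in> hom (product_group I (\<lambda>_. N)) (product_group I (\<lambda>_. N))"
      by (rule homI) (auto simp: reindex_def PiE_iff intro!: restrict_ext)
    show "reindex I \<sigma> \<one>\<^bsub>product_group I (\<lambda>_. N)\<^esub> = \<one>\<^bsub>product_group I (\<lambda>_. N)\<^esub>"
      by (auto simp: reindex_def intro!: restrict_ext)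
    fix \<tau> \<gamma> assume "\<tau> \<in> carrier (transformation_monoid I)"
    then show "reindex I (\<sigma> \<otimes>\<^bsub>transformation_monoid I\<^esub> \<tau>) \<gamma> = reindex I \<tau> (reindex I \<sigma> \<gamma>)"
      by (auto simp: reindex_def transformation_monoid_def compose_def PiE_iff intro!: restrict_ext)
  next
    fix \<gamma> assume "\<gamma> \<in> carrier (product_group I (\<lambda>_. N))"
    then show "reindex I \<one>\<^bsub>transformation_monoid I\<^esub> \<gamma> = \<gamma>"
      by (auto simp: reindex_def transformation_monoid_def PiE_iff intro!: extensionalityI[of _ I])
  qed
qed

lemma monoid_transformation_wreath: "monoid (transformation_wreath n k)"
proof -
  have "monoid (integer_mod_group k)"
    by (rule group.is_monoid) simp
  then interpret monoid_antiaction "transformation_monoid {1..n}"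
    "product_group {1..n} (\<lambda>_. integer_mod_group k)" "reindex {1..n}"
    by (rule monoid_antiaction_reindex)
  show ?thesis
    unfolding transformation_wreath_def by (rule monoid_semidirect_product)
qed

end

theory Submission
  imports Defs "HOL-Number_Theory.Cong"
begin

text \<open>
  Write \<open>F x = x\<^sup>q\<close>. A map on the field has polynomial coefficients in the subfield of order \<open>q\<close> iff it
  commutes with \<open>F\<close>, and it preserves subfields iff it preserves the sizes of \<open>F\<close>-orbits, because the
  subfield of order \<open>q\<^sup>d\<close> is the fixed set of \<open>F\<^sup>d\<close>. The orbits of size \<open>k\<close> correspond to the monic
  irreducible polynomials of degree \<open>k\<close> via minimal polynomials. Choosing a representative in every
  orbit, such a map is determined, for each \<open>k\<close>, by the map it induces on the orbits of size \<open>k\<close> and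
  by the shift modulo \<open>k\<close> of the image of each representative.
\<close>


section \<open>Equivariant maps in orbit coordinates\<close>

text \<open>Coefficients in the small field amount to commuting with \<open>F\<close> because the
  polynomial representation is unique: applying \<open>F\<close> to the coefficients represents the
  conjugate of the map by \<open>F\<close>. Commuting alone only makes the orbit size of the image
  divide that of the argument; the set differences in the notion of subfield preservation exclude a
  proper divisor. The index sets of the wreath factors count polynomials, not orbits, so the
  correspondence has to be exact: the roots of one irreducible polynomial form a single orbit, and
  every irreducible polynomial whose degree divides \<open>m\<close> really has a root in the given
  field. The field is known only through its cardinality, so this root cannot be written down; its
  existence is extracted from the quotient ring by the polynomial together with a count of
  roots.\<close>

lemma carrier_transformation_wreath:
  assumes "k > 0"
  shows "carrier (transformation_wreath l k) = ({1..l} \<rightarrow>\<^sub>E {1..l}) \<times> ({1..l} \<rightarrow>\<^sub>E {0..<int k})"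
  using assms by (simp add: transformation_wreath_def semidirect_product_def transformation_monoid_def
      carrier_integer_mod_group)

lemma mult_transformation_wreath:
  "monoid.mult (transformation_wreath l k) (\<sigma>, \<gamma>) (\<tau>, \<delta>) =
     (compose {1..l} \<sigma> \<tau>, \<lambda>i\<in>{1..l}. (reindex {1..l} \<tau> \<gamma> i + \<delta> i) mod int k)"
  by (simp add: transformation_wreath_def semidirect_product_def transformation_monoid_def)

lemma one_transformation_wreath:
  "\<one>\<^bsub>transformation_wreath l k\<^esub> = (\<lambda>i\<in>{1..l}. i, \<lambda>i\<in>{1..l}. 0)"
  by (simp add: transformation_wreath_def semidirect_product_def transformation_monoid_def)

text \<open>An action of the additive monoid of naturals with finite orbits, stripped of all field
  structure: \<open>r k i\<close> represents the \<open>i\<close>-th orbit of size \<open>k\<close>,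
  and \<open>D\<close> is the set of orbit sizes allowed. Only nonnegative powers of the generator
  exist as \<open>F j\<close>; inverses have to come from the periods.\<close>

locale orbit_coordinates =
  fixes S :: "'a set" and F :: "nat \<Rightarrow> 'a \<Rightarrow> 'a" and D :: "nat set"
    and n :: "nat \<Rightarrow> nat" and r :: "nat \<Rightarrow> nat \<Rightarrow> 'a"
  assumes F_closed: "x \<in> S \<Longrightarrow> F j x \<in> S"
    and F_0: "x \<in> S \<Longrightarrow> F 0 x = x"
    and F_add: "x \<in> S \<Longrightarrow> F (i + j) x = F i (F j x)"
    and D_pos: "k \<in> D \<Longrightarrow> k > 0"
    and r_closed: "\<lbrakk>k \<in> D; i \<in> {1..n k}\<rbrakk> \<Longrightarrow> r k i \<in> S"
    and r_period: "\<lbrakk>k \<in> D; i \<in> {1..n k}\<rbrakk> \<Longrightarrow> F j (r k i) = r k i \<longleftrightarrow> k dvd j"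
    and r_cover: "x \<in> S \<Longrightarrow> \<exists>k\<in>D. \<exists>i\<in>{1..n k}. \<exists>j. x = F j (r k i)"
    and r_separate: "\<lbrakk>k \<in> D; i \<in> {1..n k}; k' \<in> D; i' \<in> {1..n k'}; F j (r k i) = F j' (r k' i')\<rbrakk>
                       \<Longrightarrow> k = k' \<and> i = i'"
begin

context notes One_nat_def [simp del] atLeastAtMost_iff [simp del]
begin

lemma F_eq_iff:
  assumes "k \<in> D" "i \<in> {1..n k}"
  shows "F a (r k i) = F b (r k i) \<longleftrightarrow> a mod k = b mod k"
proof
  note rX = r_closed[OF assms]
  have k: "k > 0" by (rule D_pos) fact
  \<comment> \<open>\<open>c\<close> plays the role of minus \<open>a\<close> modulo
    \<open>k\<close>: since \<open>F (c + a)\<close> fixes the representative, so does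
    \<open>F (c + b)\<close>, and then \<open>k\<close> divides both sums.\<close>
  define c where "c = (k - a mod k) + k * (a div k)"
  have ca: "k dvd c + a"
  proof -
    have "c + a = k + 2 * (k * (a div k)) - a mod k + a mod k" 
      using mod_less_divisor[OF k, of a] mult_div_mod_eq[of k a] unfolding c_def by linarith
    moreover have "a mod k \<le> k" using k by simp
    ultimately have "c + a = k * (1 + 2 * (a div k))" by (simp add: algebra_simps)
    then show ?thesis by simp
  qed
  {
    assume "F a (r k i) = F b (r k i)"
    then have "F (c + a) (r k i) = F (c + b) (r k i)" by (simp add: F_add rX)
    then have "k dvd c + b" using ca r_period[OF assms] by metis
    then show "a mod k = b mod k"
      using ca by (metis cong_add_lcancel_nat cong_def dvd_imp_mod_0)
  }
  have "F a (r k i) = F (a mod k) (r k i)" for a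
  proof -
    have "F a (r k i) = F (a mod k + k * (a div k)) (r k i)" by simp
    also have "\<dots> = F (a mod k) (r k i)"
      using r_period[OF assms, of "k * (a div k)"] by (simp only: F_add rX) simp
    finally show ?thesis .
  qed
  then show "F a (r k i) = F b (r k i)" if "a mod k = b mod k" using that by metis
qed

text \<open>The bound \<open>j < k\<close> singles out one shift in its residue class, so the choice
  is in fact unique; \<open>coordinates_F\<close> computes it.\<close>

definition coords :: "'a \<Rightarrow> nat \<times> nat \<times> nat" where
  "coords x = (SOME (k, i, j). k \<in> D \<and> i \<in> {1..n k} \<and> j < k \<and> x = F j (r k i))"

definition osize :: "'a \<Rightarrow> nat" where "osize x = fst (coords x)"
definition oindex :: "'a \<Rightarrow> nat" where "oindex x = fst (snd (coords x))"
definition oshift :: "'a \<Rightarrow> nat" where "oshift x = snd (snd (coords x))"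

lemma coordinates:
  assumes "x \<in> S"
  shows "osize x \<in> D" "oindex x \<in> {1..n (osize x)}" "oshift x < osize x"
    "x = F (oshift x) (r (osize x) (oindex x))"
proof -
  obtain k i j where kij: "k \<in> D" "i \<in> {1..n k}" "x = F j (r k i)"
    using r_cover[OF assms] by blast
  then have "x = F (j mod k) (r k i)" "j mod k < k"
    using F_eq_iff[of k i j "j mod k"] D_pos by auto
  then have "\<exists>c. case c of (k, i, j) \<Rightarrow> k \<in> D \<and> i \<in> {1..n k} \<and> j < k \<and> x = F j (r k i)"
    using kij by (intro exI[of _ "(k, i, j mod k)"]) auto
  then have "case coords x of (k, i, j) \<Rightarrow> k \<in> D \<and> i \<in> {1..n k} \<and> j < k \<and> x = F j (r k i)"
    unfolding coords_def by (rule someI_ex)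
  then show "osize x \<in> D" "oindex x \<in> {1..n (osize x)}" "oshift x < osize x"
    "x = F (oshift x) (r (osize x) (oindex x))"
    by (auto simp: osize_def oindex_def oshift_def split: prod.splits)
qed

lemma coordinates_F:
  assumes "k \<in> D" "i \<in> {1..n k}"
  shows "osize (F j (r k i)) = k" "oindex (F j (r k i)) = i" "oshift (F j (r k i)) = j mod k"
proof -
  let ?x = "F j (r k i)"
  have x: "?x \<in> S" by (intro F_closed r_closed assms)
  note c = coordinates[OF x]
  have *: "k = osize ?x \<and> i = oindex ?x"
    by (rule r_separate[OF assms c(1,2) c(4)])
  then show "osize ?x = k" "oindex ?x = i" by auto
  have "F (oshift ?x) (r k i) = ?x" using c(4) * by metis
  then have "oshift ?x mod k = j mod k" using F_eq_iff[OF assms] by metis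
  then show "oshift ?x = j mod k" using c(3) * by simp
qed

lemma coordinates_r:
  assumes "k \<in> D" "i \<in> {1..n k}"
  shows "osize (r k i) = k" "oindex (r k i) = i" "oshift (r k i) = 0"
  using coordinates_F[OF assms, of 0] by (auto simp: F_0 r_closed[OF assms])

text \<open>All points of an orbit have the same period, since the shift cancels in the congruence
  modulo \<open>k\<close>. This is what turns membership in a fixed field into divisibility by the
  orbit size.\<close>

lemma F_fixed_iff:
  assumes "x \<in> S"
  shows "F d x = x \<longleftrightarrow> osize x dvd d"
proof -
  define k i j where "k = osize x" and "i = oindex x" and "j = oshift x"
  have ki: "k \<in> D" "i \<in> {1..n k}" and x: "x = F j (r k i)"
    using coordinates[OF assms] by (auto simp: k_def i_def j_def)
  have "F d x = F (d + j) (r k i)" by (simp add: x F_add r_closed ki)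
  then have "F d x = x \<longleftrightarrow> (d + j) mod k = j mod k"
    using F_eq_iff[OF ki] x by metis
  also have "\<dots> \<longleftrightarrow> k dvd d"
    using cong_add_rcancel_0_nat[of d j k] by (simp add: cong_def cong_0_iff dvd_eq_mod_eq_0)
  finally show ?thesis by (simp add: k_def)
qed

definition equivariant :: "('a \<Rightarrow> 'a) set" where
  "equivariant = {f \<in> S \<rightarrow>\<^sub>E S. (\<forall>x\<in>S. \<forall>j. f (F j x) = F j (f x)) \<and> (\<forall>x\<in>S. osize (f x) = osize x)}"

lemma equivariantD:
  assumes "f \<in> equivariant"
  shows "x \<in> S \<Longrightarrow> f x \<in> S" "x \<notin> S \<Longrightarrow> f x = undefined" "x \<in> S \<Longrightarrow> f (F j x) = F j (f x)"
    "x \<in> S \<Longrightarrow> osize (f x) = osize x"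
  using assms by (auto simp: equivariant_def)

section \<open>Translation between equivariant maps and the product of wreath monoids\<close>

definition encode :: "('a \<Rightarrow> 'a) \<Rightarrow> nat \<Rightarrow> (nat \<Rightarrow> nat) \<times> (nat \<Rightarrow> int)" where
  "encode f = (\<lambda>k\<in>D. (\<lambda>i\<in>{1..n k}. oindex (f (r k i)), \<lambda>i\<in>{1..n k}. int (oshift (f (r k i)))))"

text \<open>The unique equivariant extension of prescribed values at the representatives: the shift
  of \<open>x\<close> is added to the shift of the image of its representative.\<close>

definition decode :: "(nat \<Rightarrow> (nat \<Rightarrow> nat) \<times> (nat \<Rightarrow> int)) \<Rightarrow> 'a \<Rightarrow> 'a" where
  "decode w = (\<lambda>x\<in>S. F (oshift x + nat (snd (w (osize x)) (oindex x)))
                        (r (osize x) (fst (w (osize x)) (oindex x))))"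

abbreviation W where "W \<equiv> product_group D (\<lambda>k. transformation_wreath (n k) k)"

lemma encode_at_rep:
  assumes "f \<in> equivariant" "k \<in> D" "i \<in> {1..n k}"
  shows "oindex (f (r k i)) \<in> {1..n k}" "oshift (f (r k i)) < k"
    "f (r k i) = F (oshift (f (r k i))) (r k (oindex (f (r k i))))"
proof -
  have "f (r k i) \<in> S" "osize (f (r k i)) = k"
    using equivariantD[OF assms(1)] r_closed coordinates_r assms by auto
  with coordinates[OF this(1)] show "oindex (f (r k i)) \<in> {1..n k}" "oshift (f (r k i)) < k"
    "f (r k i) = F (oshift (f (r k i))) (r k (oindex (f (r k i))))" by auto
qed

lemma encode_closed:
  assumes "f \<in> equivariant"
  shows "encode f \<in> carrier W"
  using encode_at_rep[OF assms] by (auto simp: encode_def carrier_transformation_wreath D_pos)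

lemma decode_rep:
  assumes "w \<in> carrier W" "k \<in> D" "i \<in> {1..n k}"
  shows "fst (w k) i \<in> {1..n k}" "snd (w k) i \<in> {0..<int k}"
proof -
  have "w k \<in> ({1..n k} \<rightarrow>\<^sub>E {1..n k}) \<times> ({1..n k} \<rightarrow>\<^sub>E {0..<int k})"
    using assms carrier_transformation_wreath[OF D_pos[OF assms(2)]] by (auto simp: PiE_iff)
  then show "fst (w k) i \<in> {1..n k}" "snd (w k) i \<in> {0..<int k}"
    using assms(3) by (auto simp: PiE_iff mem_Times_iff)
qed

text \<open>The exponent \<open>j\<close> need not be reduced: the target representative has the
  same period \<open>k\<close> as the source, so replacing \<open>j\<close> by
  \<open>j mod k\<close> does not change the value.\<close>

lemma decode_F:
  assumes "k \<in> D" "i \<in> {1..n k}" "w \<in> carrier W"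
  shows "decode w (F j (r k i)) = F (j + nat (snd (w k) i)) (r k (fst (w k) i))"
proof -
  have "F j (r k i) \<in> S" by (intro F_closed r_closed assms)
  then have "decode w (F j (r k i)) = F (j mod k + nat (snd (w k) i)) (r k (fst (w k) i))"
    by (simp add: decode_def coordinates_F assms(1,2))
  also have "\<dots> = F (j + nat (snd (w k) i)) (r k (fst (w k) i))"
    using assms decode_rep by (subst F_eq_iff) (auto simp: mod_add_left_eq)
  finally show ?thesis .
qed

lemma decode_closed:
  assumes w: "w \<in> carrier W"
  shows "decode w \<in> equivariant"
  unfolding equivariant_def
proof (intro CollectI conjI ballI allI)
  show "decode w \<in> S \<rightarrow>\<^sub>E S"
    using coordinates decode_rep[OF w] 
    by (auto simp: decode_def intro!: F_closed r_closed)
next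
  fix x d assume "x \<in> S"
  then obtain k i j where ki: "k \<in> D" "i \<in> {1..n k}" and x: "x = F j (r k i)"
    using r_cover by blast
  have "F d x = F (d + j) (r k i)" by (simp add: x F_add r_closed ki)
  then show "decode w (F d x) = F d (decode w x)"
    using F_add[OF r_closed[OF ki(1) decode_rep(1)[OF w ki]], of d]
    by (simp add: decode_F[OF ki w] x add.assoc)
next
  fix x assume "x \<in> S"
  then obtain k i j where ki: "k \<in> D" "i \<in> {1..n k}" and x: "x = F j (r k i)"
    using r_cover by blast
  show "osize (decode w x) = osize x"
    using decode_rep[OF w ki] by (simp add: x decode_F[OF ki w] coordinates_F ki)
qed

lemma decode_encode:
  assumes "f \<in> equivariant"
  shows "decode (encode f) = f"
proof
  fix x show "decode (encode f) x = f x"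
  proof (cases "x \<in> S")
    case True
    then obtain k i j where ki: "k \<in> D" "i \<in> {1..n k}" and x: "x = F j (r k i)"
      using r_cover by blast
    have "decode (encode f) x = F (j + oshift (f (r k i))) (r k (oindex (f (r k i))))"
      unfolding x decode_F[OF ki encode_closed[OF assms]] using ki by (simp add: encode_def)
    also have "\<dots> = F j (f (r k i))"
      using encode_at_rep[OF assms ki] ki by (metis F_add r_closed)
    also have "\<dots> = f x"
      using equivariantD(3)[OF assms] r_closed ki by (simp add: x)
    finally show ?thesis .
  qed (simp add: equivariantD[OF assms] decode_def)
qed

lemma encode_decode:
  assumes w: "w \<in> carrier W"
  shows "encode (decode w) = w"
proof
  fix k show "encode (decode w) k = w k"
  proof (cases "k \<in> D")
    case k: True
    have wk: "w k \<in> ({1..n k} \<rightarrow>\<^sub>E {1..n k}) \<times> ({1..n k} \<rightarrow>\<^sub>E {0..<int k})"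
      using w k carrier_transformation_wreath[OF D_pos[OF k]] by (auto simp: PiE_iff)
    have at: "oindex (decode w (r k i)) = fst (w k) i"
      "int (oshift (decode w (r k i))) = snd (w k) i" if i: "i \<in> {1..n k}" for i
    proof -
      have *: "decode w (r k i) = F (nat (snd (w k) i)) (r k (fst (w k) i))"
        using decode_F[OF k i w, of 0] by (simp add: F_0 r_closed[OF k i])
      \<comment> \<open>The prescribed shift already lies in \<open>{0..<int k}\<close>, so the
        reduction modulo \<open>k\<close> in \<open>coordinates_F\<close> leaves it
        unchanged.\<close>
      show "oindex (decode w (r k i)) = fst (w k) i" "int (oshift (decode w (r k i))) = snd (w k) i"
        using decode_rep[OF w k i] k by (simp_all add: * coordinates_F nat_less_iff zmod_int)
    qed
    have "fst (encode (decode w) k) = fst (w k)"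
      using wk at(1) k by (auto simp: encode_def mem_Times_iff PiE_iff intro!: extensionalityI[of _ "{1..n k}"])
    moreover have "snd (encode (decode w) k) = snd (w k)"
      using wk at(2) k by (auto simp: encode_def mem_Times_iff PiE_iff intro!: extensionalityI[of _ "{1..n k}"])
    ultimately show ?thesis by (simp add: prod_eq_iff)
  next
    case False
    then show ?thesis using w by (simp add: encode_def PiE_iff extensional_def)
  qed
qed

text \<open>This is where the twist by \<open>reindex\<close> arises. If \<open>g\<close> sends the
  \<open>i\<close>-th representative to the \<open>i'\<close>-th one shifted by \<open>d\<close>,
  then \<open>f\<close>, commuting with the action, adds to \<open>d\<close> its own shift at
  \<open>i'\<close>, not at \<open>i\<close>.\<close>

lemma encode_compose:
  assumes f: "f \<in> equivariant" and g: "g \<in> equivariant"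
  shows "encode (compose S f g) = encode f \<otimes>\<^bsub>W\<^esub> encode g"
proof
  fix k show "encode (compose S f g) k = (encode f \<otimes>\<^bsub>W\<^esub> encode g) k"
  proof (cases "k \<in> D")
    case k: True
    have *: "oindex (f (g (r k i))) = oindex (f (r k (oindex (g (r k i)))))"
       "oshift (f (g (r k i))) = (oshift (f (r k (oindex (g (r k i))))) + oshift (g (r k i))) mod k"
      if i: "i \<in> {1..n k}" for i
    proof -
      note gi = encode_at_rep[OF g k i]
      define i' where "i' = oindex (g (r k i))"
      have i': "i' \<in> {1..n k}" using gi by (simp add: i'_def)
      note fi = encode_at_rep[OF f k i']
      have "f (g (r k i)) = F (oshift (g (r k i))) (f (r k i'))"
        using gi(3) equivariantD(3)[OF f] r_closed[OF k i'] by (metis i'_def)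
      also have "\<dots> = F (oshift (g (r k i)) + oshift (f (r k i'))) (r k (oindex (f (r k i'))))"
        using fi(3) F_add[OF r_closed[OF k fi(1)]] by metis
      finally have eq: "f (g (r k i)) = F (oshift (g (r k i)) + oshift (f (r k i'))) (r k (oindex (f (r k i'))))" .
      show "oindex (f (g (r k i))) = oindex (f (r k (oindex (g (r k i)))))"
       "oshift (f (g (r k i))) = (oshift (f (r k (oindex (g (r k i))))) + oshift (g (r k i))) mod k"
        unfolding eq coordinates_F[OF k fi(1)] by (simp_all add: i'_def add.commute)
    qed
    have [simp]: "r k i \<in> S" "oindex (g (r k i)) \<in> {1..n k}" if "i \<in> {1..n k}" for i
      using r_closed[OF k that] encode_at_rep(1)[OF g k that] by auto
    have "encode (compose S f g) k =
      (\<lambda>i\<in>{1..n k}. oindex (f (g (r k i))), \<lambda>i\<in>{1..n k}. int (oshift (f (g (r k i)))))"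
      using k by (auto simp: encode_def compose_def intro!: restrict_ext)
    also have "\<dots> = (encode f \<otimes>\<^bsub>W\<^esub> encode g) k"
      using k by (auto simp: encode_def mult_transformation_wreath compose_def reindex_def * zmod_int
          intro!: restrict_ext)
    finally show ?thesis .
  qed (simp add: encode_def)
qed

lemma encode_id: "encode (\<lambda>x\<in>S. x) = \<one>\<^bsub>W\<^esub>"
  by (auto simp: encode_def one_transformation_wreath r_closed coordinates_r intro!: restrict_ext)

text \<open>Only the three components of \<open>G\<close> are prescribed, so that a monoid defined
  by field-theoretic conditions can be inserted later. \<open>encode_id\<close> supplies the unit
  condition that \<open>monoid_isomorphic\<close> adds to \<open>iso\<close>.\<close>

lemma equivariant_isomorphic:
  fixes G :: "('a \<Rightarrow> 'a, 'c) monoid_scheme"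
  assumes "carrier G = equivariant" "monoid.mult G = compose S" "\<one>\<^bsub>G\<^esub> = (\<lambda>x\<in>S. x)"
  shows "monoid_isomorphic G W"
  unfolding monoid_isomorphic_def
proof (intro bexI[of _ encode] isoI homI)
  show "bij_betw encode (carrier G) (carrier W)"
    unfolding assms by (rule bij_betw_byWitness[of _ decode])
      (auto simp: decode_encode encode_decode encode_closed decode_closed simp del: carrier_product_group)
qed (simp_all add: assms encode_closed encode_compose encode_id del: carrier_product_group mult_product_group one_product_group)

end

end

section \<open>The Frobenius map\<close>

lemma (in cring) binomial_expansion:
  assumes x: "x \<in> carrier R" and y: "y \<in> carrier R"
  shows "(x \<oplus> y) [^] (n::nat) = (\<Oplus>k\<in>{..n}. add_pow R (n choose k) (x [^] k \<otimes> y [^] (n - k)))"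
proof (induction n)
  case 0
  then show ?case by simp
next
  case (Suc n)
  define a where "a k = x [^] k \<otimes> y [^] (Suc n - k)" for k :: nat
  define b where "b k = add_pow R (n choose k) (x [^] k \<otimes> y [^] (n - k))" for k :: nat
  \<comment> \<open>The two halves of Pascal's rule: \<open>s\<close> comes from multiplying by
    \<open>x\<close>, which shifts the index, and \<open>t\<close> from multiplying by
    \<open>y\<close>. Both are padded by a zero term, at \<open>0\<close> and at
    \<open>Suc n\<close> respectively, to share one range of summation.\<close>
  define s where "s k = add_pow R (if k = 0 then 0 else n choose (k - 1)) (a k)" for k :: nat
  define t where "t k = add_pow R (n choose k) (a k)" for k :: nat
  have ac: "a k \<in> carrier R" for k using x y by (simp add: a_def)
  have bc: "b k \<in> carrier R" for k using x y by (simp add: b_def)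
  have sc: "s k \<in> carrier R" for k using ac by (simp add: s_def)
  have tc: "t k \<in> carrier R" for k using ac by (simp add: t_def)
  have bx: "b k \<otimes> x = s (Suc k)" for k
  proof -
    have "x [^] k \<otimes> y [^] (n - k) \<otimes> x = a (Suc k)"
      using x y by (simp add: a_def m_ac)
    then show ?thesis using x y by (simp add: b_def s_def add_pow_ldistr)
  qed
  have bY: "b k \<otimes> y = t k" if "k \<le> n" for k
  proof -
    have "x [^] k \<otimes> y [^] (n - k) \<otimes> y = a k"
      using x y that by (simp add: a_def m_assoc Suc_diff_le)
    then show ?thesis using x y by (simp add: b_def t_def add_pow_ldistr)
  qed
  have "(x \<oplus> y) [^] Suc n = (\<Oplus>k\<in>{..n}. b k) \<otimes> (x \<oplus> y)"
    by (simp add: Suc b_def)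
  also have "\<dots> = (\<Oplus>k\<in>{..n}. b k) \<otimes> x \<oplus> (\<Oplus>k\<in>{..n}. b k) \<otimes> y"
    using x y bc by (simp add: r_distr)
  also have "(\<Oplus>k\<in>{..n}. b k) \<otimes> x = (\<Oplus>k\<in>{..n}. s (Suc k))"
    using x bc by (subst finsum_ldistr) (auto simp: bx)
  also have "\<dots> = (\<Oplus>k\<in>{..Suc n}. s k)"
    using sc ac by (subst finsum_Suc2) (auto simp: s_def)
  also have "(\<Oplus>k\<in>{..n}. b k) \<otimes> y = (\<Oplus>k\<in>{..n}. t k)"
    using y bc tc by (subst finsum_ldistr) (auto simp: bY intro!: finsum_cong')
  also have "\<dots> = (\<Oplus>k\<in>{..Suc n}. t k)"
    using tc ac by (subst finsum_Suc) (auto simp: t_def binomial_eq_0)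
  also have "(\<Oplus>k\<in>{..Suc n}. s k) \<oplus> (\<Oplus>k\<in>{..Suc n}. t k) = (\<Oplus>k\<in>{..Suc n}. s k \<oplus> t k)"
    using sc tc by (subst finsum_addf) auto
  also have "\<dots> = (\<Oplus>k\<in>{..Suc n}. add_pow R (Suc n choose k) (x [^] k \<otimes> y [^] (Suc n - k)))"
  proof (rule finsum_cong')
    fix k :: nat
    show "s k \<oplus> t k = add_pow R (Suc n choose k) (x [^] k \<otimes> y [^] (Suc n - k))"
      unfolding a_def[symmetric]
      using ac by (cases k) (auto simp: s_def t_def add.nat_pow_mult add.commute)
  qed (use x y in auto)
  finally show ?case .
qed

lemma (in cring) add_pow_eq_zero_of_dvd:
  assumes "add_pow R p \<one> = \<zero>" "p dvd (c::nat)" "x \<in> carrier R"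
  shows "add_pow R c x = \<zero>"
proof -
  obtain d where d: "c = p * d" using assms(2) by blast
  have "add_pow R c \<one> = add_pow R d (add_pow R p \<one>)" by (simp add: d add.nat_pow_pow)
  then have "add_pow R c \<one> = \<zero>" using assms(1) by simp
  then show ?thesis
    using add_pow_ldistr[of \<one> x c] assms(3) by simp
qed

text \<open>For exponent \<open>p\<close> the inner binomial coefficients are divisible by
  \<open>p\<close>, so only the two extreme terms survive; iterating this gives the powers of
  \<open>p\<close>.\<close>

lemma (in cring) add_prime_power:
  assumes p: "Factorial_Ring.prime (p::nat)" "add_pow R p \<one> = \<zero>" and x: "x \<in> carrier R" and y: "y \<in> carrier R"
  shows "(x \<oplus> y) [^] (p ^ e) = x [^] (p ^ e) \<oplus> y [^] (p ^ e)"
proof -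
  have prime_case: "(u \<oplus> v) [^] p = u [^] p \<oplus> v [^] p"
    if uv: "u \<in> carrier R" "v \<in> carrier R" for u v
  proof -
    obtain l where l: "p = Suc (Suc l)"
      using prime_ge_2_nat[OF p(1)] by (metis Suc_diff_Suc add_2_eq_Suc le_Suc_ex)
    let ?f = "\<lambda>k. add_pow R (p choose k) (u [^] k \<otimes> v [^] (p - k))"
    have "(u \<oplus> v) [^] p = (\<Oplus>k\<in>{..p}. ?f k)" by (rule binomial_expansion) fact+
    also have "\<dots> = (\<Oplus>k\<in>{..Suc l}. ?f (Suc k)) \<oplus> ?f 0"
      unfolding l by (rule finsum_Suc2) (use uv in auto)
    also have "(\<Oplus>k\<in>{..Suc l}. ?f (Suc k)) = ?f p \<oplus> (\<Oplus>k\<in>{..l}. ?f (Suc k))"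
      by (subst finsum_Suc) (use uv l in auto)
    also have "(\<Oplus>k\<in>{..l}. ?f (Suc k)) = (\<Oplus>k\<in>{..l}. \<zero>)"
    proof (rule finsum_cong')
      fix k assume "k \<in> {..l}"
      then have "p dvd (p choose Suc k)" using p(1) l by (intro dvd_choose_prime) auto
      then show "?f (Suc k) = \<zero>" using uv by (intro add_pow_eq_zero_of_dvd[OF p(2)]) auto
    qed auto
    finally show ?thesis using uv by (simp add: a_ac)
  qed
  show ?thesis
  proof (induction e)
    case (Suc e)
    have "(x \<oplus> y) [^] (p ^ Suc e) = ((x \<oplus> y) [^] (p ^ e)) [^] p"
      using x y by (simp add: nat_pow_pow mult.commute)
    also have "\<dots> = (x [^] (p ^ e)) [^] p \<oplus> (y [^] (p ^ e)) [^] p"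
      unfolding Suc by (rule prime_case) (use x y in auto)
    finally show ?case using x y by (simp add: nat_pow_pow mult.commute)
  qed (use x y in simp)
qed

text \<open>By Lagrange in the additive group, \<open>p ^ e\<close> times one is zero. That multiple
  is also the \<open>e\<close>-th power of \<open>p\<close> times one, and a field has no zero
  divisors.\<close>

lemma (in field) prime_card_add_pow_one:
  assumes "card (carrier R) = p ^ e" "p > 0"
  shows "add_pow R p \<one> = \<zero>"
proof -
  have "add_pow R (card (carrier R)) \<one> = \<zero>"
    using add.pow_order_eq_1[of \<one>] by (simp add: order_def)
  moreover have "add_pow R (p ^ d) \<one> = (add_pow R p \<one>) [^] d" for d
  proof (induction d)
    case (Suc d)
    have "add_pow R (p ^ Suc d) \<one> = add_pow R p (add_pow R (p ^ d) \<one>)" by (simp add: add.nat_pow_pow mult.commute)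
    also have "\<dots> = (add_pow R (p ^ d) \<one>) \<otimes> (add_pow R p \<one>)"
      using add_pow_rdistr[of "add_pow R (p ^ d) \<one>" \<one> p] by simp
    finally show ?case by (simp add: Suc)
  qed simp
  ultimately have "(add_pow R p \<one>) [^] e = \<zero>" using assms by simp
  then show ?thesis by (induction e) (auto simp: integral_iff)
qed

section \<open>Roots and interpolation over finite fields\<close>

lemma (in field) finite_field_pow_card:
  assumes "finite (carrier R)" "x \<in> carrier R"
  shows "x [^] card (carrier R) = x"
proof (cases "x = \<zero>")
  case True
  moreover have "card (carrier R) \<noteq> 0" using assms by auto
  ultimately show ?thesis by (simp add: nat_pow_zero)
next
  case False
  interpret U: group "Multiplicative_Group.mult_of R" by (rule field_mult_group)
  have "x [^] (card (carrier R) - 1) = \<one>"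
    using U.pow_order_eq_1[of x] assms False order_mult_of[OF assms(1)]
    by (simp add: order_def Multiplicative_Group.nat_pow_mult_of)
  moreover have "card (carrier R) \<noteq> 0" using assms by auto
  then obtain n where "card (carrier R) = Suc n" using not0_implies_Suc by blast
  ultimately show ?thesis using assms(2) by simp
qed

lemma (in field) card_roots_le_degree:
  assumes p: "p \<in> carrier (poly_ring R)" "p \<noteq> []"
    and A: "\<And>x. x \<in> A \<Longrightarrow> x \<in> carrier R \<and> eval p x = \<zero>"
  shows "finite A" "card A \<le> degree p"
proof -
  have sub: "A \<subseteq> set_mset (roots p)"
    using A p by (auto simp: roots_mem_iff_is_root is_root_def)
  then show "finite A" by (rule finite_subset) simp
  have "card A \<le> card (set_mset (roots p))" using sub by (intro card_mono) auto
  also have "\<dots> \<le> size (roots p)" using size_mset_mono[OF mset_set_set_mset_msubset[of "roots p"]] by simp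
  also have "\<dots> \<le> degree p" by (rule size_roots_le_degree) fact
  finally show "card A \<le> degree p" .
qed

text \<open>A nonzero difference would have degree below \<open>card A\<close> and yet vanish on all
  of \<open>A\<close>.\<close>

lemma (in field) poly_eqI_eval:
  assumes p: "p \<in> carrier (poly_ring R)" and p': "p' \<in> carrier (poly_ring R)"
    and len: "length p \<le> card A" "length p' \<le> card A"
    and A: "\<And>x. x \<in> A \<Longrightarrow> x \<in> carrier R \<and> eval p x = eval p' x"
  shows "p = p'"
proof (rule ccontr)
  assume "p \<noteq> p'"
  interpret UP: domain "poly_ring R" by (rule univ_poly_is_domain[OF carrier_is_subring])
  let ?d = "p \<ominus>\<^bsub>poly_ring R\<^esub> p'"
  have d: "?d \<in> carrier (poly_ring R)" using p p' by simp
  have nz: "?d \<noteq> []"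
    using \<open>p \<noteq> p'\<close> p p' UP.r_right_minus_eq by (simp add: univ_poly_zero)
  have "eval ?d x = \<zero>" if "x \<in> A" for x
  proof -
    interpret ev: ring_hom_cring "poly_ring R" R "\<lambda>p. eval p x"
      using eval_cring_hom[OF carrier_is_subring] A that by blast
    have "eval p' x \<in> carrier R" using ev.hom_closed[OF p'] .
    then show ?thesis using p p' A[OF that] by (simp add: a_minus_def r_neg)
  qed
  then have "card A \<le> degree ?d" using card_roots_le_degree(2)[OF d nz] A by blast
  moreover have "length ?d \<le> max (length p) (length p')"
    using poly_add_length_le[of p "\<ominus>\<^bsub>poly_ring R\<^esub> p'"] univ_poly_a_inv_length[OF carrier_is_subring p']
    by (simp add: a_minus_def univ_poly_add)
  ultimately show False using nz len by (cases ?d) auto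
qed

text \<open>For \<open>n\<close> a power of \<open>q\<close>, this is the polynomial whose roots are
  the fixed points of a Frobenius power. The bound on \<open>n\<close> keeps the two monomials
  distinct, so the difference is nonzero.\<close>

lemma (in domain) var_pow_minus_var:
  assumes K: "subring K R" and n: "n \<ge> (2::nat)"
  shows "X [^]\<^bsub>K[X]\<^esub> n \<ominus>\<^bsub>K[X]\<^esub> X \<in> carrier (K[X])" (is "?p \<in> _")
    and "X [^]\<^bsub>K[X]\<^esub> n \<ominus>\<^bsub>K[X]\<^esub> X \<noteq> []"
    and "degree (X [^]\<^bsub>K[X]\<^esub> n \<ominus>\<^bsub>K[X]\<^esub> X) \<le> n"
    and "x \<in> carrier R \<Longrightarrow> eval (X [^]\<^bsub>K[X]\<^esub> n \<ominus>\<^bsub>K[X]\<^esub> X) x = x [^] n \<ominus> x"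
proof -
  interpret UP: domain "K[X]" by (rule univ_poly_is_domain[OF K])
  note cl = var_closed(1)[OF K]
  have mon: "X [^]\<^bsub>K[X]\<^esub> n = \<one> # replicate n \<zero>"
    using unitary_monom_eq_var_pow[OF K, of n] by (simp add: monom_def)
  show "?p \<in> carrier (K[X])" using cl by simp
  have "length (X [^]\<^bsub>K[X]\<^esub> n) \<noteq> length (X :: 'a list)"
    using n unfolding mon by (simp add: var_def)
  then show "?p \<noteq> []"
    using cl UP.r_right_minus_eq[of "X [^]\<^bsub>K[X]\<^esub> n" X] by (metis UP.nat_pow_closed univ_poly_zero)
  have "length ?p \<le> max (length (X [^]\<^bsub>K[X]\<^esub> n)) (length (X :: 'a list))"
    using poly_add_length_le[of "X [^]\<^bsub>K[X]\<^esub> n" "\<ominus>\<^bsub>K[X]\<^esub> X"] univ_poly_a_inv_length[OF K cl]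
    by (simp add: a_minus_def univ_poly_add)
  then show "degree ?p \<le> n" using n unfolding mon by (simp add: var_def)
  assume x: "x \<in> carrier R"
  interpret ev: ring_hom_cring "K[X]" R "\<lambda>p. eval p x"
    using eval_cring_hom[OF K x] .
  show "eval ?p x = x [^] n \<ominus> x"
    using cl x by (simp add: a_minus_def eval_var)
qed

text \<open>Padding with leading zeros to length \<open>n\<close> is inverse to
  \<open>normalize\<close>, so these polynomials are counted as arbitrary \<open>n\<close>-tuples
  over \<open>K\<close>.\<close>

lemma (in ring) card_bounded_degree:
  assumes K: "K \<subseteq> carrier R" "\<zero> \<in> K" "finite K"
  shows "card {p \<in> carrier (K[X]). length p \<le> n} = card K ^ n"
    and "finite {p \<in> carrier (K[X]). length p \<le> n}"
proof -
  let ?L = "{l. set l \<subseteq> K \<and> length l = n}" and ?P = "{p \<in> carrier (K[X]). length p \<le> n}"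
  have "bij_betw normalize ?L ?P"
  proof (rule bij_betw_byWitness[of _ "\<lambda>p. replicate (n - length p) \<zero> @ p"])
    show "\<forall>l\<in>?L. replicate (n - length (normalize l)) \<zero> @ normalize l = l"
      using normalize_def' by (metis (mono_tags, lifting) mem_Collect_eq)
    show "\<forall>p\<in>?P. normalize (replicate (n - length p) \<zero> @ p) = p"
      by (auto simp: normalize_replicate_zero normalize_polynomial simp flip: univ_poly_carrier)
    show "normalize ` ?L \<subseteq> ?P"
      by (auto simp flip: univ_poly_carrier intro: normalize_gives_polynomial normalize_length_le)
    show "(\<lambda>p. replicate (n - length p) \<zero> @ p) ` ?P \<subseteq> ?L"
      using K by (auto simp flip: univ_poly_carrier simp: polynomial_def)
  qed
  moreover have "card ?L = card K ^ n" "finite ?L"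
    using K(3) by (simp_all add: card_lists_length_eq finite_lists_length_eq)
  ultimately show "card ?P = card K ^ n" "finite ?P"
    by (auto simp: bij_betw_same_card bij_betw_finite)
qed

lemma (in field) unique_interpolation:
  assumes fin: "finite (carrier R)" and f: "f \<in> carrier R \<rightarrow> carrier R"
  shows "\<exists>!p. p \<in> carrier (poly_ring R) \<and> degree p < card (carrier R) \<and> (\<forall>x\<in>carrier R. eval p x = f x)"
proof -
  let ?N = "card (carrier R)"
  let ?P = "{p \<in> carrier (poly_ring R). length p \<le> ?N}"
  let ?ev = "\<lambda>p. \<lambda>x\<in>carrier R. eval p x"
  \<comment> \<open>Evaluation is an injection between two finite sets with the same number of elements.\<close>
  have N: "?N > 0" using fin by (auto simp: card_gt_0_iff)
  have deg: "degree p < ?N \<longleftrightarrow> length p \<le> ?N" for p :: "'a list" using N by auto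
  have inj: "inj_on ?ev ?P"
  proof (rule inj_onI)
    fix p p' assume *: "p \<in> ?P" "p' \<in> ?P" "?ev p = ?ev p'"
    have "eval p x = eval p' x" if "x \<in> carrier R" for x
      using fun_cong[OF *(3), of x] that by simp
    then show "p = p'" using * by (intro poly_eqI_eval[of p p' "carrier R"]) auto
  qed
  have "?ev ` ?P = (carrier R \<rightarrow>\<^sub>E carrier R)"
  proof (rule card_subset_eq)
    show "finite (carrier R \<rightarrow>\<^sub>E carrier R)" using fin by (intro finite_PiE) auto
    show "?ev ` ?P \<subseteq> carrier R \<rightarrow>\<^sub>E carrier R"
      using eval_poly_in_carrier[OF carrier_is_subring] by (auto simp: univ_poly_carrier)
    show "card (?ev ` ?P) = card (carrier R \<rightarrow>\<^sub>E carrier R)"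
      using card_bounded_degree(1)[of "carrier R" ?N] fin
      by (subst card_image[OF inj]) (simp add: card_PiE)
  qed
  moreover have "restrict f (carrier R) \<in> carrier R \<rightarrow>\<^sub>E carrier R" using f by auto
  ultimately have "restrict f (carrier R) \<in> ?ev ` ?P" by simp
  then obtain p where p: "p \<in> ?P" "?ev p = restrict f (carrier R)" by (elim imageE) auto
  have pf: "eval p x = f x" if "x \<in> carrier R" for x using fun_cong[OF p(2), of x] that by simp
  show ?thesis
  proof (rule ex1I[of _ p])
    fix p' assume p': "p' \<in> carrier (poly_ring R) \<and> degree p' < ?N \<and> (\<forall>x\<in>carrier R. eval p' x = f x)"
    show "p' = p"
      using p' p(1) pf unfolding deg by (intro poly_eqI_eval[of p' p "carrier R"]) auto
  qed (use p pf deg in auto)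
qed

section \<open>Frobenius fixed fields\<close>

locale prime_power_field = field R for R (structure) +
  fixes q m :: nat
  assumes q: "primepow q" and m: "m \<ge> 1" and card_R: "card (carrier R) = q ^ m"
begin

lemma q_gt_1: "q > 1"
  using primepow_gt_Suc_0[OF q] by simp

lemma q_power_ge_2: "d > 0 \<Longrightarrow> q ^ d \<ge> 2"
  using one_less_power[OF q_gt_1, of d] by simp

lemma finite_R: "finite (carrier R)"
  using card_R q_gt_1 by (intro card_ge_0_finite) simp

definition frob :: "nat \<Rightarrow> 'a \<Rightarrow> 'a" where
  "frob j x = x [^] (q ^ j)"

lemma frob_closed [simp]: "x \<in> carrier R \<Longrightarrow> frob j x \<in> carrier R"
  by (simp add: frob_def)

lemma frob_0: "x \<in> carrier R \<Longrightarrow> frob 0 x = x"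
  by (simp add: frob_def)

lemma frob_add: "x \<in> carrier R \<Longrightarrow> frob (i + j) x = frob i (frob j x)"
  by (simp add: frob_def nat_pow_pow power_add mult.commute)

lemma frob_m: "x \<in> carrier R \<Longrightarrow> frob m x = x"
  using finite_field_pow_card[OF finite_R] by (simp add: frob_def card_R)

lemma frob_hom: "frob j \<in> ring_hom R R"
proof (rule ring_hom_memI)
  obtain p e where p: "Factorial_Ring.prime p" "q = p ^ e"
    using q by (auto simp: primepow_def)
  have "add_pow R p \<one> = \<zero>"
    using prime_card_add_pow_one[of p "e * m"] card_R p prime_gt_0_nat by (simp add: power_mult)
  then show "frob j (x \<oplus> y) = frob j x \<oplus> frob j y" if "x \<in> carrier R" "y \<in> carrier R" for x y
    using that add_prime_power[OF p(1), of x y "e * j"] by (simp add: frob_def power_mult flip: p(2))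
qed (simp_all add: frob_def nat_pow_distrib)

lemma frob_ring_hom: "ring_hom_ring R R (frob j)"
  by (intro ring_hom_ringI2 ring_axioms frob_hom)

lemma frob_inj: "inj_on (frob j) (carrier R)"
  using ring_hom_ring.img_is_subfield(1)[OF frob_ring_hom carrier_is_subfield] by simp

lemma frob_surj: "frob j ` carrier R = carrier R"
  by (rule endo_inj_surj[OF finite_R _ frob_inj]) auto

lemma frob_eval:
  "\<lbrakk>set p \<subseteq> carrier R; x \<in> carrier R\<rbrakk> \<Longrightarrow> frob j (eval p x) = eval (map (frob j) p) (frob j x)"
  by (rule ring_hom_ring.eval_hom'[OF frob_ring_hom])

definition fixed :: "nat \<Rightarrow> 'a set" where
  "fixed d = {x \<in> carrier R. frob d x = x}"

lemma fixed_subset: "fixed d \<subseteq> carrier R"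
  by (auto simp: fixed_def)

lemma fixed_subfield: "subfield (fixed d) R"
proof (rule subfieldI')
  interpret F: ring_hom_ring R R "frob d" by (rule frob_ring_hom)
  show "subring (fixed d) R"
    by (rule subringI) (auto simp: fixed_def)
  fix k assume k: "k \<in> fixed d - {\<zero>}"
  then have k': "k \<in> carrier R" "frob d k = k" "k \<in> Units R"
    by (auto simp: fixed_def field_Units)
  have "frob d (inv k) \<otimes> k = frob d (inv k \<otimes> k)"
    by (simp only: F.hom_mult Units_inv_closed k')
  also have "\<dots> = \<one>" using k' by simp
  finally have "k \<otimes> frob d (inv k) = \<one>" using k'(1,3) by (simp add: m_comm)
  then have "inv k = frob d (inv k)" using k'(1,3) by (intro comm_inv_char) auto
  then show "inv k \<in> fixed d" using k' by (simp add: fixed_def)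
qed

text \<open>Fixed points of \<open>frob d\<close> are roots of the polynomial below.
  \<open>degree_Irr_le\<close> applies the bound at an arbitrary positive period, not only at
  divisors of \<open>m\<close>.\<close>

lemma card_fixed_le:
  assumes "d > 0"
  shows "card (fixed d) \<le> q ^ d"
proof -
  note p = var_pow_minus_var[OF carrier_is_subring q_power_ge_2[OF assms]]
  have "card (fixed d) \<le> degree (X [^]\<^bsub>poly_ring R\<^esub> (q ^ d) \<ominus>\<^bsub>poly_ring R\<^esub> X)"
    by (rule card_roots_le_degree(2)[OF p(1,2)]) (use p(4) in \<open>auto simp: fixed_def frob_def\<close>)
  with p(3) show ?thesis by linarith
qed

text \<open>The lower bound exhibits the elements. With a generator \<open>a\<close> of the
  multiplicative group and \<open>e\<close> the quotient of \<open>q ^ m - 1\<close> by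
  \<open>q ^ d - 1\<close>, the powers of \<open>a ^ e\<close> give \<open>q ^ d - 1\<close>
  distinct nonzero fixed points; zero is one more.\<close>

lemma card_fixed:
  assumes d: "d dvd m"
  shows "card (fixed d) = q ^ d"
proof (rule antisym)
  have d0: "d > 0" using d m by (auto intro: Nat.gr0I)
  then show "card (fixed d) \<le> q ^ d" by (rule card_fixed_le)
  interpret U: group "Multiplicative_Group.mult_of R" by (rule field_mult_group)
  obtain a where a: "a \<in> carrier R - {\<zero>}" and gen: "carrier R - {\<zero>} = {a [^] i | i :: nat. i \<in> UNIV}"
    using finite_field_mult_group_has_gen[OF finite_R] by auto
  have ord_a: "U.ord a = q ^ m - 1"
  proof -
    have "generate (Multiplicative_Group.mult_of R) {a} = carrier R - {\<zero>}"
      using U.generate_pow_on_finite_carrier[OF finite_mult_of[OF finite_R], of a] a gen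
      by (simp add: Multiplicative_Group.nat_pow_mult_of)
    then show ?thesis
      using U.generate_pow_card[of a] a finite_R by (simp add: card_R card_Diff_singleton)
  qed
  obtain l where l: "m = d * l" using d by blast
  have "int (q ^ d - 1) dvd int ((q ^ d) ^ l - 1)"
    using power_diff_1_eq[of "int (q ^ d)" l] q_gt_1 by (simp add: of_nat_diff)
  then have "q ^ d - 1 dvd (q ^ d) ^ l - 1" by (simp only: int_dvd_int_iff)
  then obtain e where e: "q ^ m - 1 = (q ^ d - 1) * e" by (auto simp: l power_mult)
  have "q ^ m > 1" "q ^ d > 1" 
    using one_less_power[OF q_gt_1, of m] one_less_power[OF q_gt_1, of d] d0 m by auto
  then have e0: "e > 0" using e by (auto intro: Nat.gr0I)
  let ?g = "\<lambda>j. a [^] (e * j)"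
  have "inj_on ?g {..<q ^ d - 1}"
  proof (rule inj_onI)
    fix i j assume ij: "i \<in> {..<q ^ d - 1}" "j \<in> {..<q ^ d - 1}" "?g i = ?g j"
    have b: "e * i' \<in> {0..U.ord a - 1}" if "i' < q ^ d - 1" for i'
    proof -
      have "e * i' < e * (q ^ d - 1)" using that e0 by simp
      also have "\<dots> = U.ord a" using e ord_a by (simp add: mult.commute)
      finally show ?thesis by simp
    qed
    have "e * i = e * j"
      using inj_onD[OF U.ord_inj[of a], of "e * i" "e * j"] ij a b
      by (simp add: Multiplicative_Group.nat_pow_mult_of)
    then show "i = j" using e0 by simp
  qed
  then have c: "card (?g ` {..<q ^ d - 1}) = q ^ d - 1" by (simp add: card_image)
  have a1: "a [^] (q ^ m - 1) = \<one>"
    using U.pow_ord_eq_1[of a] a ord_a by (simp add: Multiplicative_Group.nat_pow_mult_of)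
  have "?g j \<in> fixed d" for j
  proof -
    \<comment> \<open>Raising to the power \<open>q ^ d\<close> changes the exponent by a multiple
      of the order of \<open>a\<close>.\<close>
    have "e * j * q ^ d = (q ^ m - 1) * j + e * j"
      using \<open>q ^ d > 1\<close> unfolding e by (cases "q ^ d") (auto simp: algebra_simps)
    then have "frob d (?g j) = (a [^] (q ^ m - 1)) [^] j \<otimes> a [^] (e * j)"
      using a by (simp add: frob_def nat_pow_pow nat_pow_mult)
    then show ?thesis using a a1 by (simp add: fixed_def)
  qed
  moreover have "\<zero> \<in> fixed d"
    using subringE(2)[OF subfieldE(1)[OF fixed_subfield]] .
  ultimately have "insert \<zero> (?g ` {..<q ^ d - 1}) \<subseteq> fixed d" by auto
  then have "card (insert \<zero> (?g ` {..<q ^ d - 1})) \<le> card (fixed d)"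
    using finite_R fixed_subset by (intro card_mono) (auto intro: finite_subset)
  moreover have "\<zero> \<notin> ?g ` {..<q ^ d - 1}"
    using a gen by auto
  ultimately show "q ^ d \<le> card (fixed d)" using c \<open>q ^ d > 1\<close> by simp
qed

text \<open>In a subfield with \<open>q ^ d\<close> elements every \<open>x\<close> satisfies
  \<open>x [^] (q ^ d) = x\<close>, so the subfield lies in \<open>fixed d\<close>; equal
  cardinalities force equality.\<close>

lemma subfield_of_card_eq:
  assumes d: "d dvd m"
  shows "subfield_of_card R (q ^ d) = fixed d"
  unfolding subfield_of_card_def
proof (rule the_equality)
  show "subfield (fixed d) R \<and> card (fixed d) = q ^ d"
    using fixed_subfield card_fixed[OF d] by simp
  fix K assume K: "subfield K R \<and> card K = q ^ d"
  interpret K: field "R\<lparr>carrier := K\<rparr>" using subfield_iff(2) K by blast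
  have Ks: "K \<subseteq> carrier R" using K subfieldE(3) by blast
  have "finite K" using Ks finite_R by (rule finite_subset)
  then have "x [^] (q ^ d) = x" if "x \<in> K" for x
    using K.finite_field_pow_card[of x] that K by (simp add: nat_pow_consistent[symmetric])
  then have "K \<subseteq> fixed d" using Ks by (auto simp: fixed_def frob_def)
  then show "K = fixed d"
    using card_fixed[OF d] K finite_R fixed_subset
    by (intro card_subset_eq) (auto intro: finite_subset)
qed


section \<open>Frobenius orbits and minimal polynomials\<close>

lemma frob_mult_period:
  assumes "x \<in> carrier R" "frob d x = x"
  shows "frob (d * t) x = x"
  using assms by (induction t) (simp_all add: frob_0 frob_add)

lemma commutes_frob:
  assumes f: "f \<in> carrier R \<rightarrow> carrier R" and c: "\<And>x. x \<in> carrier R \<Longrightarrow> f (frob 1 x) = frob 1 (f x)"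
    and x: "x \<in> carrier R"
  shows "f (frob j x) = frob j (f x)"
proof (induction j)
  case 0
  then show ?case using f x by (simp add: frob_0 Pi_iff)
next
  case (Suc j)
  have "f (frob (1 + j) x) = frob 1 (f (frob j x))"
    using x by (simp only: frob_add c frob_closed)
  also have "\<dots> = frob (1 + j) (f x)"
    using f x by (simp only: frob_add Suc Pi_iff)
  finally show ?case by simp
qed

text \<open>If \<open>f\<close> commutes with Frobenius, then \<open>p\<close> and the polynomial
  with Frobenius applied to its coefficients agree at every \<open>frob 1 x\<close>, hence
  everywhere by surjectivity, and uniqueness identifies them.\<close>

lemma coefficients_fixed_iff:
  assumes f: "f \<in> carrier R \<rightarrow> carrier R"
  shows "set (poly_rep R f) \<subseteq> fixed 1 \<longleftrightarrow> (\<forall>x\<in>carrier R. f (frob 1 x) = frob 1 (f x))"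
proof -
  define p where "p = poly_rep R f"
  have "p \<in> carrier (poly_ring R) \<and> degree p < card (carrier R) \<and> (\<forall>x\<in>carrier R. eval p x = f x)"
    unfolding p_def poly_rep_def by (rule theI'[OF unique_interpolation[OF finite_R f]])
  then have p: "p \<in> carrier (poly_ring R)" "length p \<le> card (carrier R)"
    and pf: "\<And>x. x \<in> carrier R \<Longrightarrow> eval p x = f x" by auto
  have pc: "set p \<subseteq> carrier R" using p(1) polynomial_incl by (auto simp flip: univ_poly_carrier)
  have "map (frob 1) p = p" if comm: "\<forall>x\<in>carrier R. f (frob 1 x) = frob 1 (f x)"
  proof (rule poly_eqI_eval[where A = "carrier R"])
    interpret F: ring_hom_ring R R "frob 1" by (rule frob_ring_hom)
    \<comment> \<open>Injectivity keeps the leading coefficient nonzero, so the mapped list is still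
      a normalized polynomial.\<close>
    have "frob 1 a \<noteq> \<zero>" if "a \<in> carrier R" "a \<noteq> \<zero>" for a
      using inj_onD[OF frob_inj, of 1 a \<zero>] that F.hom_zero by auto
    then show "map (frob 1) p \<in> carrier (poly_ring R)"
      using p(1) pc unfolding univ_poly_carrier[symmetric] polynomial_def by (cases p) auto
    fix y assume y: "y \<in> carrier R"
    then obtain x where x: "x \<in> carrier R" "y = frob 1 x" using frob_surj[of 1] by auto
    have "eval (map (frob 1) p) y = frob 1 (f x)"
      using frob_eval[OF pc x(1), of 1] by (simp add: x pf)
    also have "\<dots> = eval p y" using comm pf[OF y] x by simp
    finally show "y \<in> carrier R \<and> eval (map (frob 1) p) y = eval p y" using y by simp
  qed (use p in auto)
  moreover have "map (frob 1) p = p \<longleftrightarrow> set p \<subseteq> fixed 1"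
    using pc map_eq_conv[of "frob 1" p id] by (auto simp: fixed_def)
  moreover have "f (frob 1 x) = frob 1 (f x)" if "map (frob 1) p = p" "x \<in> carrier R" for x
    using frob_eval[OF pc that(2), of 1] that by (simp add: pf)
  ultimately show ?thesis unfolding p_def[symmetric] by blast
qed

section \<open>Minimal polynomials over the fixed field of order \<open>q\<close>\<close>

definition K :: "'a set" where
  "K = fixed 1"

lemma K_subfield: "subfield K R"
  unfolding K_def by (rule fixed_subfield)

lemmas K_subring = subfieldE(1)[OF K_subfield]

lemma card_K: "card K = q"
  using card_fixed[of 1] by (simp add: K_def)

lemma K_subset: "K \<subseteq> carrier R"
  unfolding K_def by (rule fixed_subset)

lemma finite_K: "finite K"
  unfolding K_def using finite_subset[OF fixed_subset finite_R] .

lemma zero_in_K: "\<zero> \<in> K"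
  using subringE(2)[OF K_subring] .

lemma card_bounded_degree_K:
  "card {p \<in> carrier (K[X]). length p \<le> n} = q ^ n" "finite {p \<in> carrier (K[X]). length p \<le> n}"
  using card_bounded_degree[OF K_subset zero_in_K finite_K, of n] by (simp_all add: card_K)

lemma K_fixed: "K \<subseteq> fixed j"
  using frob_mult_period[of _ 1 j] by (auto simp: K_def fixed_def)

lemma algebraic_over_K:
  assumes x: "x \<in> carrier R"
  shows "(algebraic over K) x"
proof -
  have "q ^ m \<ge> 2" using m by (intro q_power_ge_2) simp
  note p = var_pow_minus_var[OF K_subring this]
  show ?thesis
    by (rule algebraicI[OF p(1,2)]) (use p(4)[OF x] frob_m[OF x] x in \<open>simp add: frob_def\<close>)
qed

lemmas Irr_props = IrrE[OF K_subfield _ algebraic_over_K]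

lemma Irr_eqI:
  assumes "x \<in> carrier R" "p \<in> carrier (K[X])" "pirreducible K p" "lead_coeff p = \<one>" "eval p x = \<zero>"
  shows "Irr K x = p"
  using minimal_polynomial_is_unique[OF K_subfield assms(1) algebraic_over_K[OF assms(1)]]
    Irr_props[OF assms(1) assms(1)] assms by blast

lemma frob_eval_K:
  assumes p: "p \<in> carrier (K[X])" and x: "x \<in> carrier R"
  shows "frob j (eval p x) = eval p (frob j x)"
proof -
  have pK: "set p \<subseteq> K" using p polynomial_incl by (auto simp flip: univ_poly_carrier)
  then have "map (frob j) p = p"
    using K_fixed[of j] by (intro map_idI) (auto simp: fixed_def)
  then show ?thesis
    using frob_eval[of p x j] pK K_subset x by auto
qed

lemma eval_frob_zero:
  assumes "p \<in> carrier (K[X])" "x \<in> carrier R" "eval p x = \<zero>"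
  shows "eval p (frob j x) = \<zero>"
proof -
  interpret F: ring_hom_ring R R "frob j" by (rule frob_ring_hom)
  show ?thesis using frob_eval_K[OF assms(1,2), of j] assms(3) by simp
qed

lemma Irr_frob:
  assumes "x \<in> carrier R"
  shows "Irr K (frob j x) = Irr K x"
  using assms Irr_props[OF assms assms] by (intro Irr_eqI) (auto intro: eval_frob_zero)

lemma degree_Irr_pos:
  assumes "x \<in> carrier R"
  shows "degree (Irr K x) > 0"
  using pirreducible_degree[OF K_subfield] Irr_props[OF assms assms] by fastforce

lemma degree_Irr_le:
  assumes x: "x \<in> carrier R" and j: "j > 0" "frob j x = x"
  shows "degree (Irr K x) \<le> j"
proof -
  \<comment> \<open>Evaluation at \<open>x\<close> embeds the \<open>q ^ ?k\<close> polynomials of degree below \<open>?k\<close> into \<open>fixed j\<close>.\<close>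
  let ?k = "degree (Irr K x)"
  let ?P = "{p \<in> carrier (K[X]). length p \<le> ?k}"
  interpret UP: domain "K[X]" by (rule univ_poly_is_domain[OF K_subring])
  interpret ev: ring_hom_cring "K[X]" R "\<lambda>p. eval p x" by (rule eval_cring_hom[OF K_subring x])
  have "inj_on (\<lambda>p. eval p x) ?P"
  proof (rule inj_onI, rule ccontr)
    fix l l' assume l: "l \<in> ?P" "l' \<in> ?P" "eval l x = eval l' x" and "l \<noteq> l'"
    let ?d = "l \<ominus>\<^bsub>K[X]\<^esub> l'"
    have d: "?d \<in> carrier (K[X])" using l by simp
    have nz: "?d \<noteq> []"
      using \<open>l \<noteq> l'\<close> l UP.r_right_minus_eq by (simp add: univ_poly_zero)
    have "eval ?d x = \<zero>"
      using l ev.hom_closed[of l'] by (simp add: a_minus_def r_neg)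
    then have "(Irr K x) pdivides ?d"
      by (intro Irr_minimal[OF K_subfield x algebraic_over_K[OF x] d])
    then have "?k \<le> degree ?d"
      using Irr_props(1)[OF x x] by (intro pdivides_imp_degree_le[OF K_subring _ d nz])
    moreover have "length ?d \<le> max (length l) (length l')"
      using poly_add_length_le[of l "\<ominus>\<^bsub>K[X]\<^esub> l'"] univ_poly_a_inv_length[OF K_subring, of l'] l
      by (simp add: a_minus_def univ_poly_add)
    ultimately show False using nz l by (cases ?d) auto
  qed
  then have "q ^ ?k = card ((\<lambda>p. eval p x) ` ?P)"
    by (simp add: card_image card_bounded_degree_K)
  also have "\<dots> \<le> card (fixed j)"
  proof (intro card_mono finite_subset[OF fixed_subset finite_R] image_subsetI)
    fix p assume "p \<in> ?P"
    then show "eval p x \<in> fixed j"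
      using frob_eval_K[of p x j] x j ev.hom_closed[of p] by (simp add: fixed_def)
  qed
  also have "\<dots> \<le> q ^ j" by (rule card_fixed_le[OF j(1)])
  finally show ?thesis using power_le_imp_le_exp[OF q_gt_1] by blast
qed

lemma finite_card_roots_K:
  assumes "p \<in> carrier (K[X])" "p \<noteq> []" and "\<And>x. x \<in> A \<Longrightarrow> x \<in> carrier R \<and> eval p x = \<zero>"
  shows "finite A" "card A \<le> degree p"
  using card_roots_le_degree[OF carrier_polynomial_shell[OF K_subring assms(1)] assms(2), of A] assms(3)
  by blast+

lemma Irr_orbit_root:
  assumes "x \<in> carrier R"
  shows "eval (Irr K x) (frob j x) = \<zero>" "Irr K x \<noteq> []"
  using Irr_props[OF assms assms] assms degree_Irr_pos[OF assms] by (auto intro: eval_frob_zero)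

lemma frob_fixed_difference:
  assumes "x \<in> carrier R" "frob i x = frob j x" "i < j"
  shows "frob (j - i) x = x"
proof -
  have "frob i (frob (j - i) x) = frob i x"
    using assms frob_add[of x i "j - i"] by simp
  then show ?thesis using inj_onD[OF frob_inj[of i]] assms by simp
qed

text \<open>Pigeonhole: the iterates with exponents from 0 to the degree are one more than the roots
  available, so two coincide. Their difference is a period at most the degree, and by
  \<open>degree_Irr_le\<close> at least the degree.\<close>

lemma frob_degree_Irr:
  assumes x: "x \<in> carrier R"
  shows "frob (degree (Irr K x)) x = x"
proof -
  let ?k = "degree (Irr K x)"
  have "\<not> inj_on (\<lambda>j. frob j x) {..?k}"
  proof
    assume "inj_on (\<lambda>j. frob j x) {..?k}"
    then have "card ((\<lambda>j. frob j x) ` {..?k}) = Suc ?k" by (simp add: card_image)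
    moreover have "card ((\<lambda>j. frob j x) ` {..?k}) \<le> ?k"
      using Irr_orbit_root[OF x] Irr_props(1)[OF x x] x by (intro finite_card_roots_K(2)) auto
    ultimately show False by simp
  qed
  then obtain i j where ij: "i < j" "j \<le> ?k" "frob i x = frob j x"
    by (auto simp: inj_on_def) (metis nat_neq_iff)
  then have "frob (j - i) x = x" by (intro frob_fixed_difference x)
  moreover from this have "?k \<le> j - i" using ij by (intro degree_Irr_le x) auto
  ultimately show ?thesis using ij by (metis diff_le_self le_antisym le_trans)
qed

text \<open>The degree is the least positive period, so the remainder of a period modulo it must be
  zero.\<close>

lemma frob_eq_iff_degree_Irr_dvd:
  assumes x: "x \<in> carrier R"
  shows "frob j x = x \<longleftrightarrow> degree (Irr K x) dvd j"
proof
  let ?k = "degree (Irr K x)"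
  show "frob j x = x" if "?k dvd j"
    using that frob_mult_period[OF x frob_degree_Irr[OF x]] by (auto simp: dvd_def)
  assume j: "frob j x = x"
  have "frob j x = frob (j mod ?k) (frob (?k * (j div ?k)) x)"
    using x by (simp flip: frob_add)
  then have "frob (j mod ?k) x = x"
    using frob_mult_period[OF x frob_degree_Irr[OF x]] j by simp
  then have "j mod ?k = 0"
    using degree_Irr_le[OF x, of "j mod ?k"] mod_less_divisor[OF degree_Irr_pos[OF x], of j] by linarith
  then show "?k dvd j" by (simp add: dvd_eq_mod_eq_0)
qed

text \<open>The orbit of \<open>x\<close> already supplies as many roots as the degree allows; a
  root \<open>y\<close> outside it would be one too many.\<close>

lemma Irr_eq_imp_orbit:
  assumes x: "x \<in> carrier R" and y: "y \<in> carrier R" and eq: "Irr K x = Irr K y"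
  shows "\<exists>j. y = frob j x"
proof (rule ccontr)
  assume *: "\<nexists>j. y = frob j x"
  let ?k = "degree (Irr K x)"
  let ?O = "(\<lambda>j. frob j x) ` {..<?k}"
  have False if "i < j" "j < ?k" "frob i x = frob j x" for i j
    using frob_fixed_difference[OF x that(3,1)] frob_eq_iff_degree_Irr_dvd[OF x, of "j - i"] that
    by (simp add: nat_dvd_not_less)
  then have "inj_on (\<lambda>j. frob j x) {..<?k}"
    by (intro inj_onI) (metis lessThan_iff nat_neq_iff)
  then have "card (insert y ?O) = Suc ?k" using * by (subst card_insert_disjoint) (auto simp: card_image)
  moreover have "card (insert y ?O) \<le> ?k"
    using Irr_orbit_root[OF x] Irr_props(1)[OF x x] Irr_props(4)[OF y y] x y
    by (intro finite_card_roots_K(2)) (auto simp: eq)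
  ultimately show False by simp
qed

lemma irreducible_has_root:
  assumes p: "p \<in> carrier (K[X])" "pirreducible K p" and dvd: "degree p dvd m"
  shows "\<exists>x\<in>carrier R. eval p x = \<zero>"
proof (rule ccontr)
  assume no_root: "\<not> ?thesis"
  \<comment> \<open>The quotient field by \<open>p\<close> shows that \<open>p\<close> divides \<open>X ^ (q ^ m) - X\<close>, which vanishes everywhere. If \<open>p\<close>
    has no root, then the cofactor vanishes everywhere too, but its degree is too small.\<close>
  let ?k = "degree p" and ?s = "rupture_surj K p"
  let ?P = "(\<lambda>l. l pmod p) ` carrier (K[X])"
  interpret UP: domain "K[X]" by (rule univ_poly_is_domain[OF K_subring])
  interpret L: field "Rupt K p"
    using rupture_is_field_iff_pirreducible[OF K_subfield p(1)] p(2) by blast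
  interpret s: ring_hom_ring "K[X]" "Rupt K p" ?s by (rule rupture_surj_hom(2)[OF K_subring p(1)])
  have p0: "p \<noteq> []" and k: "?k \<ge> 1"
    using pirreducibleE(1)[OF K_subring p] pirreducible_degree[OF K_subfield p] by auto
  have P: "?P = {l \<in> carrier (K[X]). length l \<le> ?k}"
    by (rule pmod_image_characterization[OF K_subfield p(1) p0])
  have inj: "inj_on ?s ?P" by (rule rupture_surj_inj_on[OF K_subfield p(1)])
  have carrier_L: "?s ` ?P = carrier (Rupt K p)"
    by (rule rupture_carrier_as_pmod_image[OF K_subfield p(1)])
  have card_L: "card (carrier (Rupt K p)) = q ^ ?k" "finite (carrier (Rupt K p))"
    unfolding carrier_L[symmetric] card_image[OF inj] unfolding P
    by (simp_all add: card_bounded_degree_K)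
  have X: "X \<in> carrier (K[X])" by (rule var_closed(1)[OF K_subring])
  define y where "y = ?s X"
  have y: "y \<in> carrier (Rupt K p)" unfolding y_def using X by (rule s.hom_closed)
  \<comment> \<open>\<open>y\<close> is the residue class of the variable in a field with
    \<open>q ^ ?k\<close> elements, so it is fixed by the power \<open>q ^ ?k\<close>. Since
    \<open>?k\<close> divides \<open>m\<close>, iteration reaches \<open>q ^ m\<close>.\<close>
  have "y [^]\<^bsub>Rupt K p\<^esub> (q ^ (?k * t)) = y" for t
  proof (induction t)
    case (Suc t)
    have "y [^]\<^bsub>Rupt K p\<^esub> (q ^ (?k * Suc t)) = (y [^]\<^bsub>Rupt K p\<^esub> (q ^ ?k)) [^]\<^bsub>Rupt K p\<^esub> (q ^ (?k * t))"
      using y by (simp add: L.nat_pow_pow power_add)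
    then show ?case using L.finite_field_pow_card[OF card_L(2) y] Suc by (simp add: card_L)
  qed (use y in simp)
  then have ypow: "y [^]\<^bsub>Rupt K p\<^esub> (q ^ m) = y" using dvd by (metis dvd_def)
  have "q ^ m \<ge> 2" using m by (intro q_power_ge_2) simp
  note w = var_pow_minus_var[OF K_subring this]
  let ?w = "X [^]\<^bsub>K[X]\<^esub> (q ^ m) \<ominus>\<^bsub>K[X]\<^esub> X"
  have "?s ?w = \<zero>\<^bsub>Rupt K p\<^esub>"
    using X y ypow by (simp add: a_minus_def s.hom_nat_pow L.r_neg flip: y_def)
  also have "\<dots> = ?s []" using s.hom_zero by (simp add: univ_poly_zero)
  finally have "?s (?w pmod p) = ?s ([] pmod p)"
    using rupture_surj_composed_with_pmod[OF K_subfield p(1)] w(1) univ_poly_zero_closed by metis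
  then have "?w pmod p = [] pmod p"
    using w(1) univ_poly_zero_closed by (intro inj_onD[OF inj]) auto
  then have "?w pmod p = []" using long_division_zero(2)[OF K_subfield p(1)] by simp
  then have "p pdivides ?w" using pmod_zero_iff_pdivides[OF K_subfield w(1) p(1)] by blast
  \<comment> \<open>\<open>pdivides\<close> is divisibility over the whole field, so the cofactor
    lives in \<open>poly_ring R\<close>, where its roots in \<open>R\<close> can be counted.\<close>
  then obtain r where r: "r \<in> carrier (poly_ring R)" "?w = p \<otimes>\<^bsub>poly_ring R\<^esub> r"
    unfolding pdivides_def factor_def by blast
  have p': "p \<in> carrier (poly_ring R)" by (rule carrier_polynomial_shell[OF K_subring p(1)])
  have wr: "?w = poly_mult p r" using r(2) by (simp add: univ_poly_mult)
  have r0: "r \<noteq> []"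
    using w(2) wr poly_mult_zero(2)[of p] polynomial_incl[of "carrier R" p] p'
    by (auto simp: univ_poly_carrier)
  have "degree ?w = ?k + degree r"
    unfolding wr using poly_mult_degree_eq[OF carrier_is_subring, of p r] p' r(1) p0 r0
    by (simp add: univ_poly_carrier)
  then have deg_r: "degree r < q ^ m" using w(3) k by linarith
  have "eval r x = \<zero>" if x: "x \<in> carrier R" for x
  proof -
    interpret ev: ring_hom_cring "poly_ring R" R "\<lambda>p. eval p x"
      using eval_cring_hom[OF carrier_is_subring x] .
    have "eval p x \<otimes> eval r x = eval ?w x" using r p' by simp
    also have "\<dots> = \<zero>" using w(4)[OF x] frob_m[OF x] x by (simp add: frob_def)
    finally show ?thesis
      using no_root x ev.hom_closed[OF p'] ev.hom_closed[OF r(1)] integral by blast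
  qed
  then have "card (carrier R) \<le> degree r"
    by (intro card_roots_le_degree(2)[OF r(1) r0]) auto
  then show False using deg_r card_R by simp
qed


section \<open>Subfield preserving maps\<close>

definition monic_irreducibles :: "nat \<Rightarrow> 'a list set" where
  "monic_irreducibles k = {p \<in> carrier (K[X]). pirreducible K p \<and> lead_coeff p = \<one> \<and> degree p = k}"

lemma finite_monic_irreducibles: "finite (monic_irreducibles k)"
  by (rule finite_subset[OF _ card_bounded_degree_K(2)[of "Suc k"]]) (auto simp: monic_irreducibles_def)

definition nth_irreducible :: "nat \<Rightarrow> nat \<Rightarrow> 'a list" where
  "nth_irreducible k = (SOME h. bij_betw h {1..card (monic_irreducibles k)} (monic_irreducibles k))"

lemma nth_irreducible_bij:
  "bij_betw (nth_irreducible k) {1..card (monic_irreducibles k)} (monic_irreducibles k)"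
  unfolding nth_irreducible_def
  by (rule someI_ex[OF ex_bij_betw_nat_finite_1[OF finite_monic_irreducibles]])

text \<open>Any root will do, because the roots form a single orbit; one exists when
  \<open>k\<close> divides \<open>m\<close>, by \<open>irreducible_has_root\<close>.\<close>

definition orbit_rep :: "nat \<Rightarrow> nat \<Rightarrow> 'a" where
  "orbit_rep k i = (SOME x. x \<in> carrier R \<and> eval (nth_irreducible k i) x = \<zero>)"

lemma orbit_rep:
  assumes "k dvd m" "i \<in> {1..card (monic_irreducibles k)}"
  shows "orbit_rep k i \<in> carrier R" "Irr K (orbit_rep k i) = nth_irreducible k i"
    "degree (nth_irreducible k i) = k"
proof -
  have p: "nth_irreducible k i \<in> monic_irreducibles k"
    using bij_betwE[OF nth_irreducible_bij] assms(2) by blast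
  then have "\<exists>x. x \<in> carrier R \<and> eval (nth_irreducible k i) x = \<zero>"
    using irreducible_has_root[of "nth_irreducible k i"] assms(1) by (auto simp: monic_irreducibles_def)
  then have *: "orbit_rep k i \<in> carrier R \<and> eval (nth_irreducible k i) (orbit_rep k i) = \<zero>"
    unfolding orbit_rep_def by (rule someI_ex)
  then show "orbit_rep k i \<in> carrier R" by simp
  show "Irr K (orbit_rep k i) = nth_irreducible k i"
    using * p by (intro Irr_eqI) (auto simp: monic_irreducibles_def)
  show "degree (nth_irreducible k i) = k" using p by (simp add: monic_irreducibles_def)
qed

text \<open>The minimal polynomial is a complete invariant of orbits: its Frobenius invariance
  separates the representatives, and \<open>Irr_eq_imp_orbit\<close> shows that they cover the
  field. Its degree is the period.\<close>

sublocale orbit_coordinates "carrier R" frob "{k. k dvd m}" "\<lambda>k. card (monic_irreducibles k)" orbit_rep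
proof
  fix x assume x: "x \<in> carrier R"
  let ?k = "degree (Irr K x)"
  have "?k dvd m" using frob_eq_iff_degree_Irr_dvd[OF x] frob_m[OF x] by blast
  moreover have "Irr K x \<in> monic_irreducibles ?k"
    using Irr_props[OF x x] by (simp add: monic_irreducibles_def)
  then have "Irr K x \<in> nth_irreducible ?k ` {1..card (monic_irreducibles ?k)}"
    by (simp only: bij_betw_imp_surj_on[OF nth_irreducible_bij])
  then obtain i where i: "i \<in> {1..card (monic_irreducibles ?k)}" "Irr K x = nth_irreducible ?k i"
    by blast
  ultimately have "\<exists>j. x = frob j (orbit_rep ?k i)"
    using Irr_eq_imp_orbit[of "orbit_rep ?k i" x] orbit_rep[of ?k i] x by simp
  then show "\<exists>k\<in>{k. k dvd m}. \<exists>i\<in>{1..card (monic_irreducibles k)}. \<exists>j. x = frob j (orbit_rep k i)"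
    using \<open>?k dvd m\<close> i(1) by blast
next
  fix k i k' i' j j'
  assume *: "k \<in> {k. k dvd m}" "i \<in> {1..card (monic_irreducibles k)}"
    "k' \<in> {k. k dvd m}" "i' \<in> {1..card (monic_irreducibles k')}"
    "frob j (orbit_rep k i) = frob j' (orbit_rep k' i')"
  then have eq: "nth_irreducible k i = nth_irreducible k' i'"
    using orbit_rep[of k i] orbit_rep[of k' i'] Irr_frob by (metis mem_Collect_eq)
  then have "k = k'" using orbit_rep(3)[of k i] orbit_rep(3)[of k' i'] * by simp
  then show "k = k' \<and> i = i'"
    using inj_onD[OF bij_betw_imp_inj_on[OF nth_irreducible_bij[of k]] eq[folded \<open>k = k'\<close>]] * by simp
next
  fix k i j assume "k \<in> {k. k dvd m}" "i \<in> {1..card (monic_irreducibles k)}"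
  then show "frob j (orbit_rep k i) = orbit_rep k i \<longleftrightarrow> k dvd j"
    using orbit_rep[of k i] frob_eq_iff_degree_Irr_dvd by simp
next
  fix k assume "k \<in> {k. k dvd m}"
  then show "k > 0" using m by (auto intro: Nat.gr0I)
qed (use frob_0 frob_add orbit_rep in auto)

lemma mem_fixed_iff: "x \<in> carrier R \<Longrightarrow> x \<in> fixed d \<longleftrightarrow> osize x dvd d"
  by (auto simp: fixed_def F_fixed_iff)

text \<open>Commutation gives \<open>osize (f x) dvd osize x\<close>. If the converse divisibility
  failed, \<open>x\<close> would lie in the difference of the fixed fields for
  \<open>osize x\<close> and \<open>osize (f x)\<close>, but \<open>f x\<close> could not.
  Conversely, \<open>osize\<close> decides membership in every fixed field.\<close>

lemma subfield_preserving_iff: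
  assumes f: "f \<in> carrier R \<rightarrow> carrier R"
    and comm: "\<And>x j. x \<in> carrier R \<Longrightarrow> f (frob j x) = frob j (f x)"
  shows "subfield_preserving R q m f \<longleftrightarrow> (\<forall>x\<in>carrier R. osize (f x) = osize x)"
proof
  have q1: "subfield_of_card R q = fixed 1" using subfield_of_card_eq[of 1] by simp
  have fx: "f x \<in> carrier R" if "x \<in> carrier R" for x using f that by auto
  {
    assume sp: "subfield_preserving R q m f"
    show "\<forall>x\<in>carrier R. osize (f x) = osize x"
    proof
      fix x assume x: "x \<in> carrier R"
      note D = coordinates(1)[OF x] coordinates(1)[OF fx[OF x]]
      have "frob (osize x) (f x) = f x"
        using comm[OF x, of "osize x"] F_fixed_iff[OF x, of "osize x"] by simp
      then have dvd: "osize (f x) dvd osize x" using F_fixed_iff[OF fx[OF x]] by simp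
      have "osize x dvd osize (f x)"
      proof (rule ccontr)
        assume "\<not> osize x dvd osize (f x)"
        then have "x \<in> fixed (osize x) - fixed (osize (f x))"
          using x by (simp add: mem_fixed_iff)
        moreover have "f ` (fixed (osize x) - fixed (osize (f x))) \<subseteq> fixed (osize x) - fixed (osize (f x))"
          using sp D unfolding subfield_preserving_def by (simp add: subfield_of_card_eq)
        ultimately have "f x \<in> fixed (osize x) - fixed (osize (f x))" by blast
        then show False using fx[OF x] by (simp add: mem_fixed_iff)
      qed
      with dvd show "osize (f x) = osize x" by (rule dvd_antisym)
    qed
  }
  {
    assume o: "\<forall>x\<in>carrier R. osize (f x) = osize x"
    have mem: "f x \<in> fixed d \<longleftrightarrow> x \<in> fixed d" if "x \<in> carrier R" for x d
      using o that fx by (simp add: mem_fixed_iff)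
    show "subfield_preserving R q m f"
      using mem fixed_subset
      by (auto simp: subfield_preserving_def q1 subfield_of_card_eq) 
  }
qed

lemma carrier_subfield_preserving_monoid:
  "carrier (subfield_preserving_monoid R q m) = equivariant"
proof -
  have q1: "subfield_of_card R q = fixed 1" using subfield_of_card_eq[of 1] by simp
  have "f \<in> carrier (subfield_preserving_monoid R q m) \<longleftrightarrow> f \<in> equivariant"
    if f: "f \<in> carrier R \<rightarrow>\<^sub>E carrier R" for f
  proof -
    have f': "f \<in> carrier R \<rightarrow> carrier R" using f by auto
    have "set (poly_rep R f) \<subseteq> subfield_of_card R q \<longleftrightarrow> (\<forall>x\<in>carrier R. \<forall>j. f (frob j x) = frob j (f x))"
      unfolding q1 coefficients_fixed_iff[OF f'] using commutes_frob[OF f'] by blast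
    then show ?thesis
      using f subfield_preserving_iff[OF f'] by (auto simp: subfield_preserving_monoid_def equivariant_def)
  qed
  moreover have "carrier (subfield_preserving_monoid R q m) \<subseteq> carrier R \<rightarrow>\<^sub>E carrier R"
    by (auto simp: subfield_preserving_monoid_def)
  moreover have "equivariant \<subseteq> carrier R \<rightarrow>\<^sub>E carrier R"
    by (auto simp: equivariant_def)
  ultimately show ?thesis by blast
qed

lemma subfield_preserving_monoid_isomorphic:
  "monoid_isomorphic (subfield_preserving_monoid R q m)
     (product_group {k. k dvd m}
        (\<lambda>k. transformation_wreath (num_monic_irreducible R (subfield_of_card R q) k) k))"
proof -
  have "num_monic_irreducible R (subfield_of_card R q) k = card (monic_irreducibles k)" for k
    using subfield_of_card_eq[of 1] by (simp add: num_monic_irreducible_def monic_irreducibles_def K_def)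
  moreover have "monoid_isomorphic (subfield_preserving_monoid R q m)
     (product_group {k. k dvd m} (\<lambda>k. transformation_wreath (card (monic_irreducibles k)) k))"
    by (rule equivariant_isomorphic[OF carrier_subfield_preserving_monoid])
      (simp_all add: subfield_preserving_monoid_def)
  ultimately show ?thesis by simp
qed

end

theorem theorem13:
  fixes R :: "('a, 'b) ring_scheme" and q m :: nat
  assumes "primepow q" and "m \<ge> 1"
    and "field R" and "card (carrier R) = q ^ m"
  shows "monoid_isomorphic
           (subfield_preserving_monoid R q m)
           (product_group {k. k dvd m}
              (\<lambda>k. transformation_wreath (num_monic_irreducible R (subfield_of_card R q) k) k))"
proof -
  interpret prime_power_field R q m
    using assms by (simp add: prime_power_field_def prime_power_field_axioms_def)
  show ?thesis by (rule subfield_preserving_monoid_isomorphic)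
qed

end
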